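(* Let $\Delta$ be a positive integer and let $G$ be a graph with $n$ vertices, maximum degree at most $\Delta$, and no isolated vertex. Then $$\nu_{ac}(G) \geq \frac{6n}{\Delta^2+12\Delta^{3/2}}.$$
   Context: All graphs are simple, finite and undirected. A matching $M$ in a graph $G$ is acyclic if the subgraph of $G$ induced by the set of vertices incident to an edge of $M$ is a forest. The acyclic matching number $\nu_{ac}(G)$ is the largest size of an acyclic matching in $G$. *)

theory Defs
  imports Complex_Main
begin

definition simple_graph :: "'a set \<Rightarrow> 'a set set \<Rightarrow> bool" where
  "simple_graph V E \<longleftrightarrow> finite V \<and> (\<forall>e\<in>E. \<exists>u v. e = {u, v} \<and> u \<in> V \<and> v \<in> V \<and> u \<noteq> v)"

definition degree :: "'a set set \<Rightarrow> 'a \<Rightarrow> nat" where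
  "degree E v = card {e\<in>E. v \<in> e}"

definition has_cycle :: "'a set \<Rightarrow> 'a set set \<Rightarrow> bool" where
  "has_cycle S F \<longleftrightarrow> (\<exists>vs. length vs \<ge> 3 \<and> distinct vs \<and> set vs \<subseteq> S \<and>
      (\<forall>i < length vs. {vs ! i, vs ! ((i + 1) mod length vs)} \<in> F))"

definition forest :: "'a set \<Rightarrow> 'a set set \<Rightarrow> bool" where
  "forest S F \<longleftrightarrow> \<not> has_cycle S F"

definition induced_edges :: "'a set set \<Rightarrow> 'a set \<Rightarrow> 'a set set" where
  "induced_edges E S = {e\<in>E. e \<subseteq> S}"

definition matching :: "'a set set \<Rightarrow> 'a set set \<Rightarrow> bool" where
  "matching E M \<longleftrightarrow> M \<subseteq> E \<and> (\<forall>e1\<in>M. \<forall>e2\<in>M. e1 \<noteq> e2 \<longrightarrow> e1 \<inter> e2 = {})"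

definition acyclic_matching :: "'a set set \<Rightarrow> 'a set set \<Rightarrow> bool" where
  "acyclic_matching E M \<longleftrightarrow> matching E M \<and> forest (\<Union>M) (induced_edges E (\<Union>M))"

definition acyclic_matching_number :: "'a set set \<Rightarrow> nat" where
  "acyclic_matching_number E = Max (card ` {M. acyclic_matching E M})"

end

(* Partition V into stars with at least one leaf each. For a set S of centers, choose a uniformly
   random leaf in every star; the center-leaf edges form a matching, and contracting them turns the
   edges between them into a multigraph on S. A set of its vertices that is 1-degenerate, in the
   sense that each vertex in turn sends at most one edge to the earlier ones, yields an acyclic
   matching. Keeping, in a random order, the vertices with at most one edge to earlier ones gives
   such a set of expected size at least the sum of 2/(D+2) over the multigraph degrees D, while the
   expected sum of the D is at most the sum of Delta - k + (Delta - 1)/k, k being the number of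
   leaves. Linearising 2/(D+2) finishes: with all stars if Delta <= 16, and otherwise by combining
   the bounds obtained from the stars with at least 7 and with at most 6 leaves. *)

theory Submission
  imports Defs
begin

section \<open>Growing a forest by a vertex or by an edge\<close>

text \<open>A cycle that avoids \<open>x\<close> lies in \<open>S\<close>, and a cycle through
  \<open>x\<close> would give \<open>x\<close> two neighbours in \<open>S\<close>.\<close>

lemma forest_insert:
  assumes S: "finite S" "forest S (induced_edges E S)"
    and x: "x \<notin> S" "card {v\<in>S. {x, v} \<in> E} \<le> 1"
  shows "forest (insert x S) (induced_edges E (insert x S))"
  unfolding forest_def
proof
  assume "has_cycle (insert x S) (induced_edges E (insert x S))"
  then obtain vs where len: "length vs \<ge> 3" and dist: "distinct vs"
    and sub: "set vs \<subseteq> insert x S"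
    and edge: "\<And>i. i < length vs \<Longrightarrow>
      {vs ! i, vs ! ((i + 1) mod length vs)} \<in> induced_edges E (insert x S)"
    unfolding has_cycle_def by blast
  let ?n = "length vs"
  show False
  proof (cases "x \<in> set vs")
    case False
    then have "set vs \<subseteq> S" using sub by blast
    moreover have "{vs ! i, vs ! ((i + 1) mod ?n)} \<in> induced_edges E S" if "i < ?n" for i
    proof -
      have "(i + 1) mod ?n < ?n" using len by (intro mod_less_divisor) linarith
      then have "vs ! i \<in> S" "vs ! ((i + 1) mod ?n) \<in> S"
        using that calculation nth_mem by blast+
      then show ?thesis using edge[OF that] by (simp add: induced_edges_def)
    qed
    ultimately have "has_cycle S (induced_edges E S)"
      unfolding has_cycle_def using len dist by blast
    then show False using S(2) by (simp add: forest_def)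
  next
    case True
    then obtain i where i: "i < ?n" "vs ! i = x" by (metis in_set_conv_nth)
    \<comment> \<open>\<open>j\<close> and \<open>k\<close> are the positions after and before
      \<open>i\<close> around the cycle. They differ because a cycle has length at least 3, so
      \<open>x\<close> has two distinct neighbours on it.\<close>
    define j where "j = (i + 1) mod ?n"
    define k where "k = (if i = 0 then ?n - 1 else i - 1)"
    have j: "j < ?n" unfolding j_def using len by (intro mod_less_divisor) linarith
    have j': "j = (if i = ?n - 1 then 0 else i + 1)"
    proof (cases "i = ?n - 1")
      case True
      then have "i + 1 = ?n" using len by linarith
      then show ?thesis using True by (simp add: j_def)
    next
      case False
      then have "i + 1 < ?n" using i by linarith
      then show ?thesis using False by (simp add: j_def)
    qed
    have k: "k < ?n" using i len by (auto simp: k_def)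
    have kk: "(k + 1) mod ?n = i"
    proof (cases "i = 0")
      case True
      then have "k + 1 = ?n" using len by (simp add: k_def)
      then show ?thesis using True by simp
    qed (use i in \<open>simp add: k_def\<close>)
    have ne: "j \<noteq> i" "k \<noteq> i" "j \<noteq> k" using i len by (auto simp: j' k_def)
    have "vs ! j \<noteq> x" "vs ! k \<noteq> x" "vs ! j \<noteq> vs ! k"
      using ne i j k dist by (auto simp: nth_eq_iff_index_eq simp flip: i(2))
    moreover have "vs ! j \<in> insert x S" "vs ! k \<in> insert x S"
      using sub j k nth_mem by blast+
    moreover have "{x, vs ! j} \<in> E"
      using edge[OF i(1)] i j_def by (simp add: induced_edges_def)
    moreover have "{x, vs ! k} \<in> E"
      using edge[OF k] i kk by (simp add: induced_edges_def insert_commute)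
    ultimately have "{vs ! j, vs ! k} \<subseteq> {v\<in>S. {x, v} \<in> E}" "card {vs ! j, vs ! k} = 2"
      by auto
    then show False
      using card_mono[of "{v\<in>S. {x, v} \<in> E}" "{vs ! j, vs ! k}"] S(1) x(2) by simp
  qed
qed

text \<open>An indicator with numeric values, so that edge counts become sums that can be rearranged
  and averaged.\<close>

definition adj :: "'a set set \<Rightarrow> 'a \<Rightarrow> 'a \<Rightarrow> nat" where
  "adj E u v = of_bool ({u, v} \<in> E)"

lemma adj_commute: "adj E u v = adj E v u"
  by (simp add: adj_def insert_commute)

lemma sum_adj: "finite S \<Longrightarrow> (\<Sum>v\<in>S. adj E x v) = card {v\<in>S. {x, v} \<in> E}"
  by (simp add: adj_def Int_def)

text \<open>One of \<open>x\<close> and \<open>y\<close> has no neighbour in \<open>S\<close>.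
  Inserted after the other endpoint, it has at most that endpoint as a neighbour, so
  \<open>forest_insert\<close> applies twice, whether or not \<open>x\<close> and \<open>y\<close>
  are adjacent.\<close>

lemma forest_insert_edge:
  assumes S: "finite S" "forest S (induced_edges E S)"
    and xy: "x \<notin> S" "y \<notin> S" "x \<noteq> y"
    and le: "(\<Sum>v\<in>S. adj E x v + adj E y v) \<le> 1"
  shows "forest (insert x (insert y S)) (induced_edges E (insert x (insert y S)))"
proof -
  have aux: "forest (insert y (insert x S)) (induced_edges E (insert y (insert x S)))"
    if "x \<notin> S" "y \<notin> S" "x \<noteq> y" "card {v\<in>S. {x, v} \<in> E} \<le> 1" "card {v\<in>S. {y, v} \<in> E} = 0" for x y
  proof (rule forest_insert)
    show "forest (insert x S) (induced_edges E (insert x S))"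
      by (rule forest_insert[OF S that(1) that(4)])
    have "{v\<in>S. {y, v} \<in> E} = {}"
      using that(5) S(1) by simp
    then have "{v \<in> insert x S. {y, v} \<in> E} \<subseteq> {x}" by blast
    then show "card {v \<in> insert x S. {y, v} \<in> E} \<le> 1"
      using card_mono[of "{x}"] by simp
    show "finite (insert x S)" "y \<notin> insert x S" using that S(1) by auto
  qed
  have "card {v\<in>S. {x, v} \<in> E} + card {v\<in>S. {y, v} \<in> E} \<le> 1"
    using le by (simp add: sum.distrib sum_adj[OF S(1)])
  then consider "card {v\<in>S. {x, v} \<in> E} \<le> 1" "card {v\<in>S. {y, v} \<in> E} = 0"
    | "card {v\<in>S. {y, v} \<in> E} \<le> 1" "card {v\<in>S. {x, v} \<in> E} = 0" by linarith
  then show ?thesis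
  proof cases
    case 1
    then show ?thesis using aux[OF xy] unfolding insert_commute[of x y] by blast
  next
    case 2
    then show ?thesis using aux[of y x] xy by blast
  qed
qed

section \<open>Large 1-degenerate sets in multigraphs\<close>

text \<open>\<open>w u v\<close> is the multiplicity of the edge between \<open>u\<close> and
  \<open>v\<close>, so one double edge to \<open>T\<close> already excludes \<open>u\<close>. The
  order of insertion is the degeneracy order.\<close>

inductive one_degenerate :: "('i \<Rightarrow> 'i \<Rightarrow> nat) \<Rightarrow> 'i set \<Rightarrow> bool" for w where
  empty: "one_degenerate w {}"
| insert: "one_degenerate w T \<Longrightarrow> u \<notin> T \<Longrightarrow> (\<Sum>v\<in>T. w u v) \<le> 1 \<Longrightarrow> one_degenerate w (insert u T)"

text \<open>The probability that, in a random order, a vertex with \<^term>\<open>a\<close> simple and \<^term>\<open>b\<close>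
  multiple neighbours is preceded by at most one edge.\<close>

definition survival :: "nat \<Rightarrow> nat \<Rightarrow> real" where
  "survival a b = (if a + b = 0 then 1 else (2 * real a + real b) / (real (a + b) * (real (a + b) + 1)))"

text \<open>Condition on which of the vertex and its \<open>a + b\<close> neighbours comes last, all
  being equally likely. Leaving out a last neighbour lowers \<open>a\<close> or \<open>b\<close>; if
  the vertex itself is last, it survives exactly when \<open>a \<le> 1\<close> and
  \<open>b = 0\<close>. Truncated subtraction at 0 is harmless because of the factor 0.\<close>

lemma survival_rec:
  "(real a + real b + 1) * survival a b =
    real a * survival (a - 1) b + real b * survival a (b - 1) + of_bool (a \<le> 1 \<and> b = 0)"
proof -
  \<comment> \<open>For \<open>a + b \<ge> 2\<close> the reduced arguments are not both 0, so the
    quotient formula holds for them too.\<close>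
  consider "a + b = 0" | "a = 1" "b = 0" | "a = 0" "b = 1" | "a + b \<ge> 2" by linarith
  then show ?thesis
  proof cases
    case 4
    have e: "real a * survival (a - 1) b = real a * (2 * real a + real b - 2) / ((real a + real b - 1) * (real a + real b))"
    proof (cases "a = 0")
      case False
      then have "real (a - 1) = real a - 1" "a - 1 + b \<noteq> 0" using 4 by linarith+
      then show ?thesis by (simp add: survival_def of_nat_diff algebra_simps)
    qed simp
    have f: "real b * survival a (b - 1) = real b * (2 * real a + real b - 1) / ((real a + real b - 1) * (real a + real b))"
    proof (cases "b = 0")
      case False
      then have "real (b - 1) = real b - 1" "a + (b - 1) \<noteq> 0" using 4 by linarith+
      then show ?thesis by (simp add: survival_def of_nat_diff algebra_simps)
    qed simp
    define s where "s = real a + real b"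
    have s: "s \<ge> 2" using 4 by (simp add: s_def flip: of_nat_add)
    have l: "(real a + real b + 1) * survival a b = (2 * real a + real b) / s"
      using 4 s by (auto simp: survival_def s_def)
    have "real a * (2 * real a + real b - 2) + real b * (2 * real a + real b - 1) = (2 * real a + real b) * (s - 1)"
      by (simp add: s_def algebra_simps)
    then have "real a * survival (a - 1) b + real b * survival a (b - 1) = (2 * real a + real b) * (s - 1) / ((s - 1) * s)"
      unfolding e f by (simp add: s_def flip: add_divide_distrib)
    also have "\<dots> = (2 * real a + real b) / s" using s by simp
    finally show ?thesis using l 4 by auto
  qed (auto simp: survival_def)
qed

text \<open>\<open>a + 2 * b\<close> is the least degree possible with such neighbours. For
  \<open>a + b > 0\<close>, clearing denominators leaves the two sides differing by
  \<open>a * b + 2 * a\<close>.\<close>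

lemma survival_ge: "survival a b \<ge> 2 / (real a + 2 * real b + 2)"
proof (cases "a + b = 0")
  case False
  then have p: "real (a + b) > 0" by linarith
  have "2 * (real (a + b) * (real (a + b) + 1)) \<le> (2 * real a + real b) * (real a + 2 * real b + 2)"
    by (simp add: algebra_simps)
  then show ?thesis using False p
    by (simp add: survival_def divide_simps del: of_nat_add)
qed (simp add: survival_def)

definition simple_deg :: "('i \<Rightarrow> 'i \<Rightarrow> nat) \<Rightarrow> 'i set \<Rightarrow> 'i \<Rightarrow> nat" where
  "simple_deg w S u = card {v \<in> S - {u}. w u v = 1}"

definition multi_deg :: "('i \<Rightarrow> 'i \<Rightarrow> nat) \<Rightarrow> 'i set \<Rightarrow> 'i \<Rightarrow> nat" where
  "multi_deg w S u = card {v \<in> S - {u}. w u v \<ge> 2}"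

text \<open>This is \<open>survival_rec\<close> read as conditioning on the last vertex of a random
  order of \<open>S\<close>: only the removal of a neighbour of \<open>u\<close> changes its
  probability, and the indicator covers the case that \<open>u\<close> itself is last.\<close>

lemma sum_survival_remove:
  assumes "finite S" "u \<in> S"
  shows "(\<Sum>v\<in>S - {u}. survival (simple_deg w (S - {v}) u) (multi_deg w (S - {v}) u))
      + of_bool ((\<Sum>v\<in>S - {u}. w u v) \<le> 1)
    \<ge> real (card S) * survival (simple_deg w S u) (multi_deg w S u)"
proof -
  define A where "A = {v \<in> S - {u}. w u v = 1}"
  define B where "B = {v \<in> S - {u}. w u v \<ge> 2}"
  define Z where "Z = {v \<in> S - {u}. w u v = 0}"
  have fin: "finite A" "finite B" "finite Z" using assms by (auto simp: A_def B_def Z_def)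
  have split: "S - {u} = A \<union> (B \<union> Z)" by (auto simp: A_def B_def Z_def)
  have disj: "A \<inter> (B \<union> Z) = {}" "B \<inter> Z = {}" by (auto simp: A_def B_def Z_def)
  have ab: "simple_deg w S u = card A" "multi_deg w S u = card B"
    by (simp_all add: simple_deg_def multi_deg_def A_def B_def)
  let ?g = "\<lambda>v. survival (simple_deg w (S - {v}) u) (multi_deg w (S - {v}) u)"
  have rem: "simple_deg w (S - {v}) u = card (A - {v})" "multi_deg w (S - {v}) u = card (B - {v})" for v
    unfolding simple_deg_def multi_deg_def A_def B_def by (rule arg_cong[where f = card], blast)+
  have gA: "?g v = survival (card A - 1) (card B)" if "v \<in> A" for v
  proof -
    have "v \<notin> B" using that by (auto simp: A_def B_def)
    then show ?thesis using that fin unfolding rem by simp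
  qed
  have gB: "?g v = survival (card A) (card B - 1)" if "v \<in> B" for v
  proof -
    have "v \<notin> A" using that by (auto simp: A_def B_def)
    then show ?thesis using that fin unfolding rem by simp
  qed
  have gZ: "?g v = survival (card A) (card B)" if "v \<in> Z" for v
  proof -
    have "v \<notin> A" "v \<notin> B" using that by (auto simp: A_def B_def Z_def)
    then show ?thesis unfolding rem by simp
  qed
  have "sum ?g (S - {u}) = sum ?g A + (sum ?g B + sum ?g Z)"
    unfolding split using fin disj by (simp add: sum.union_disjoint)
  also have "\<dots> = real (card A) * survival (card A - 1) (card B)
      + (real (card B) * survival (card A) (card B - 1) + real (card Z) * survival (card A) (card B))"
    using gA gB gZ by simp
  finally have sum: "sum ?g (S - {u}) = \<dots>" .
  have "card (S - {u}) = card A + (card B + card Z)"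
    unfolding split using fin disj by (simp add: card_Un_disjoint)
  moreover have "card S = card (S - {u}) + 1" using card_Suc_Diff1[OF assms] by simp
  ultimately have cS: "real (card S) = real (card A) + real (card B) + 1 + real (card Z)" by simp
  have "of_bool (card A \<le> 1 \<and> card B = 0) \<le> (of_bool ((\<Sum>v\<in>S - {u}. w u v) \<le> 1) :: real)"
  proof (cases "card A \<le> 1 \<and> card B = 0")
    case True
    then have "B = {}" using fin by simp
    then have "(\<Sum>v\<in>S - {u}. w u v) = (\<Sum>v\<in>A. w u v) + (\<Sum>v\<in>Z. w u v)"
      unfolding split using fin disj by (simp add: sum.union_disjoint)
    also have "\<dots> = card A" by (simp add: A_def Z_def)
    finally show ?thesis using True by simp
  qed auto
  then show ?thesis
    unfolding ab cS sum using survival_rec[of "card A" "card B"]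
    by (simp add: algebra_simps)
qed

lemma sum_offdiag_swap:
  assumes "finite S"
  shows "(\<Sum>c\<in>S. \<Sum>d\<in>S - {c}. g d c) = (\<Sum>c\<in>S. \<Sum>d\<in>S - {c}. g c d)"
proof -
  have 1: "S - {x} = {y \<in> S. x \<noteq> y}" for x by auto
  have 2: "{x \<in> S. x \<noteq> y} = S - {y}" for y by auto
  show ?thesis using sum.swap_restrict[OF assms assms, of "\<lambda>c d. g d c" "(\<noteq>)"]
    unfolding 2 unfolding 1[symmetric] .
qed

text \<open>The random order is fixed from its end: some last vertex \<open>v\<close> does at least
  as well as the average. It joins the set found in \<open>S - {v}\<close> if it sends at most one
  edge to \<open>S - {v}\<close>, and is dropped otherwise.\<close>

lemma one_degenerate_subset_survival:
  assumes "finite S"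
  shows "\<exists>T\<subseteq>S. one_degenerate w T \<and>
    (\<Sum>u\<in>S. survival (simple_deg w S u) (multi_deg w S u)) \<le> real (card T)"
  using assms
proof (induction "card S" arbitrary: S rule: less_induct)
  case less
  define \<Phi> where "\<Phi> S u = survival (simple_deg w S u) (multi_deg w S u)" for S u
  show ?case
  proof (cases "S = {}")
    case True
    then show ?thesis using one_degenerate.empty by auto
  next
    case False
    let ?b = "\<lambda>u. of_bool ((\<Sum>v\<in>S - {u}. w u v) \<le> 1) :: real"
    \<comment> \<open>If every \<open>v\<close> fell short, summing over \<open>v\<close> and
      exchanging the two sums would contradict \<open>sum_survival_remove\<close>.\<close>
    have "\<exists>v\<in>S. sum (\<Phi> S) S \<le> sum (\<Phi> (S - {v})) (S - {v}) + ?b v"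
    proof (rule ccontr)
      assume "\<not> ?thesis"
      then have "(\<Sum>v\<in>S. sum (\<Phi> (S - {v})) (S - {v}) + ?b v) < (\<Sum>v\<in>S. sum (\<Phi> S) S)"
        using False less.prems by (intro sum_strict_mono) auto
      also have "\<dots> = (\<Sum>u\<in>S. real (card S) * \<Phi> S u)"
        by (simp add: sum_distrib_left)
      also have "\<dots> \<le> (\<Sum>u\<in>S. (\<Sum>v\<in>S - {u}. \<Phi> (S - {v}) u) + ?b u)"
        unfolding \<Phi>_def using less.prems by (intro sum_mono sum_survival_remove)
      also have "\<dots> = (\<Sum>u\<in>S. \<Sum>v\<in>S - {u}. \<Phi> (S - {v}) u) + sum ?b S"
        by (simp only: sum.distrib)
      also have "(\<Sum>u\<in>S. \<Sum>v\<in>S - {u}. \<Phi> (S - {v}) u) = (\<Sum>v\<in>S. \<Sum>u\<in>S - {v}. \<Phi> (S - {v}) u)"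
        using less.prems by (rule sum_offdiag_swap)
      finally show False by (simp add: sum.distrib)
    qed
    then obtain v where v: "v \<in> S" "sum (\<Phi> S) S \<le> sum (\<Phi> (S - {v})) (S - {v}) + ?b v" by blast
    have "card (S - {v}) < card S" using v(1) less.prems by (intro psubset_card_mono) auto
    then obtain T where T: "T \<subseteq> S - {v}" "one_degenerate w T"
      "sum (\<Phi> (S - {v})) (S - {v}) \<le> real (card T)"
      using less.hyps[of "S - {v}"] less.prems unfolding \<Phi>_def by auto
    show ?thesis
    proof (cases "(\<Sum>u\<in>S - {v}. w v u) \<le> 1")
      case True
      have "(\<Sum>u\<in>T. w v u) \<le> (\<Sum>u\<in>S - {v}. w v u)"
        using T(1) less.prems by (intro sum_mono2) auto
      then have "one_degenerate w (insert v T)"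
        using True T by (intro one_degenerate.insert) auto
      moreover have "card (insert v T) = card T + 1"
        using T(1) less.prems by (metis Diff_iff Suc_eq_plus1 card_insert_disjoint finite_Diff finite_subset insertI1 subsetD)
      ultimately show ?thesis
        using v T True unfolding \<Phi>_def
        by (intro exI[of _ "insert v T"]) auto
    next
      case False
      then show ?thesis
        using v T unfolding \<Phi>_def by (intro exI[of _ T]) auto
    qed
  qed
qed

text \<open>A bound of Caro-Wei type, with degrees counted by multiplicity: a multiple neighbour
  adds at least 2 to the degree, so \<open>survival_ge\<close> applies.\<close>

lemma one_degenerate_subset:
  assumes "finite S"
  shows "\<exists>T\<subseteq>S. one_degenerate w T \<and>
    (\<Sum>u\<in>S. 2 / (real (\<Sum>v\<in>S - {u}. w u v) + 2)) \<le> real (card T)"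
proof -
  have "2 / (real (\<Sum>v\<in>S - {u}. w u v) + 2) \<le> survival (simple_deg w S u) (multi_deg w S u)" for u
  proof -
    let ?A = "{v \<in> S - {u}. w u v = 1}" and ?B = "{v \<in> S - {u}. w u v \<ge> 2}"
    have "simple_deg w S u + 2 * multi_deg w S u = (\<Sum>v\<in>?A. 1) + (\<Sum>v\<in>?B. 2)"
      by (simp add: simple_deg_def multi_deg_def)
    also have "\<dots> \<le> (\<Sum>v\<in>?A. w u v) + (\<Sum>v\<in>?B. w u v)"
      by (intro add_mono sum_mono) auto
    also have "\<dots> = (\<Sum>v\<in>?A \<union> ?B. w u v)"
      using assms by (intro sum.union_disjoint[symmetric]) auto
    also have "\<dots> \<le> (\<Sum>v\<in>S - {u}. w u v)"
      using assms by (intro sum_mono2) auto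
    finally have "real (simple_deg w S u) + 2 * real (multi_deg w S u) \<le> real (\<Sum>v\<in>S - {u}. w u v)"
      by linarith
    then have "2 / (real (\<Sum>v\<in>S - {u}. w u v) + 2)
        \<le> 2 / (real (simple_deg w S u) + 2 * real (multi_deg w S u) + 2)"
      by (intro divide_left_mono mult_pos_pos) auto
    then show ?thesis using survival_ge order_trans by blast
  qed
  then have le: "(\<Sum>u\<in>S. 2 / (real (\<Sum>v\<in>S - {u}. w u v) + 2))
      \<le> (\<Sum>u\<in>S. survival (simple_deg w S u) (multi_deg w S u))"
    by (rule sum_mono)
  obtain T where "T \<subseteq> S" "one_degenerate w T"
    "(\<Sum>u\<in>S. survival (simple_deg w S u) (multi_deg w S u)) \<le> real (card T)"
    using one_degenerate_subset_survival[OF assms] by blast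
  then show ?thesis using le by (intro exI[of _ T] conjI) auto
qed


section \<open>Partition into stars\<close>

text \<open>\<open>p\<close> sends each vertex to the center of its star, so centers are the fixed
  points; the last condition gives every star a leaf.\<close>

definition star_map :: "'a set set \<Rightarrow> 'a set \<Rightarrow> ('a \<Rightarrow> 'a) \<Rightarrow> bool" where
  "star_map E V p \<longleftrightarrow> (\<forall>v\<in>V. p v \<in> V \<and> p (p v) = p v \<and> (p v \<noteq> v \<longrightarrow> {v, p v} \<in> E)) \<and>
    (\<forall>c\<in>V. p c = c \<longrightarrow> (\<exists>v\<in>V. v \<noteq> c \<and> p v = c))"

text \<open>If \<open>y\<close> is a center, \<open>x\<close> becomes its leaf. Otherwise
  \<open>y\<close> becomes a center with leaf \<open>x\<close>: either \<open>y\<close> is new, or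
  it quits a star that keeps another leaf, or it was the only leaf of its star and the old center
  becomes its leaf.\<close>

lemma star_map_insert:
  assumes p: "star_map E W p" and x: "x \<notin> W" and e: "{x, y} \<in> E" "x \<noteq> y"
  shows "\<exists>p'. star_map E (insert x (insert y W)) p'"
proof -
  have idem: "p (p z) = p z" if "z \<in> W" for z using p that by (simp add: star_map_def)
  have root: "\<exists>v\<in>W. v \<noteq> c \<and> p v = c" if "c \<in> W" "p c = c" for c
    using p that by (simp add: star_map_def)
  consider "y \<in> W" "p y = y" | "y \<notin> W"
    | "y \<in> W" "p y \<noteq> y" "\<exists>z\<in>W. z \<noteq> y \<and> z \<noteq> p y \<and> p z = p y"
    | "y \<in> W" "p y \<noteq> y" "\<forall>z\<in>W. p z = p y \<longrightarrow> z = y \<or> z = p y" by blast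
  then show ?thesis
  proof cases
    case 1
    then show ?thesis using p x e unfolding star_map_def
      by (intro exI[of _ "p(x := y)"]) (auto simp: insert_absorb)
  next
    case 2
    then show ?thesis using p x e unfolding star_map_def
      by (intro exI[of _ "p(x := y, y := y)"]) auto
  next
    case 3
    then obtain z where z: "z \<in> W" "z \<noteq> y" "z \<noteq> p y" "p z = p y" by blast
    \<comment> \<open>Values of \<open>p\<close> are fixed points and \<open>y\<close> is not one,
      so no vertex is attached to \<open>y\<close> before the change.\<close>
    have y: "p z \<noteq> y" if "z \<in> W" for z using 3(2) idem[OF that] by metis
    have "\<exists>v\<in>insert x W. v \<noteq> c \<and> (p(x := y, y := y)) v = c"
      if c: "c \<in> W" "c \<noteq> y" "p c = c" for c
    proof -
      obtain v where v: "v \<in> W" "v \<noteq> c" "p v = c" using root[OF c(1,3)] by blast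
      have "\<exists>v\<in>W. v \<noteq> y \<and> v \<noteq> c \<and> p v = c" using v z by (cases "v = y") auto
      then show ?thesis using x by fastforce
    qed
    then show ?thesis using p x e 3(1) y unfolding star_map_def
      by (intro exI[of _ "p(x := y, y := y)"]) (auto simp: insert_absorb)
  next
    case 4
    have y: "p z \<noteq> y" if "z \<in> W" for z using 4(2) idem[OF that] by metis
    have "\<exists>v\<in>insert x W. v \<noteq> c \<and> (p(x := y, y := y, p y := y)) v = c"
      if c: "c \<in> W" "c \<noteq> y" "c \<noteq> p y" "p c = c" for c
    proof -
      obtain v where v: "v \<in> W" "v \<noteq> c" "p v = c" using root[OF c(1,4)] by blast
      then have "v \<noteq> y" "v \<noteq> p y" using c idem[OF 4(1)] by auto
      then show ?thesis using v x by fastforce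
    qed
    moreover have "p z \<noteq> p y" if "z \<in> W" "z \<noteq> y" "z \<noteq> p y" for z using 4(3) that by blast
    moreover have "p y \<in> W" "{p y, y} \<in> E" "p y \<noteq> x"
      using p 4 x unfolding star_map_def by (auto simp: insert_commute)
    ultimately show ?thesis using p x e 4(1,2) y unfolding star_map_def
      by (intro exI[of _ "p(x := y, y := y, p y := y)"]) (auto simp: insert_absorb)
  qed
qed

text \<open>Vertices are covered one at a time. Covering \<open>x\<close> may also bring in its
  neighbour \<open>y\<close>, so the covered set \<open>W\<close> is only required to contain
  \<open>X\<close>.\<close>

lemma star_map_exists:
  assumes fin: "finite V" and e: "\<And>v. v \<in> V \<Longrightarrow> \<exists>u\<in>V. {v, u} \<in> E \<and> v \<noteq> u"
  shows "\<exists>p. star_map E V p"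
proof -
  have "\<exists>W p. X \<subseteq> W \<and> W \<subseteq> V \<and> star_map E W p" if "finite X" "X \<subseteq> V" for X
    using that
  proof (induction X)
    case empty
    show ?case by (intro exI[of _ "{}"]) (simp add: star_map_def)
  next
    case (insert x X)
    then obtain W p where W: "X \<subseteq> W" "W \<subseteq> V" "star_map E W p" by blast
    show ?case
    proof (cases "x \<in> W")
      case True
      then show ?thesis using W by blast
    next
      case False
      obtain y where "y \<in> V" "{x, y} \<in> E" "x \<noteq> y" using e insert.prems by blast
      then show ?thesis using star_map_insert[OF W(3) False] W insert.prems
        by (intro exI[of _ "insert x (insert y W)"]) auto
    qed
  qed
  from this[OF fin order_refl] show ?thesis by (metis order_antisym)
qed

section \<open>Choices no worse than the average\<close>

lemma weighted_le_ex:
  fixes X :: "'i \<Rightarrow> real"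
  assumes "\<And>u. u \<in> K \<Longrightarrow> q u \<ge> 0" "sum q K = 1" "(\<Sum>u\<in>K. q u * X u) \<le> m"
  shows "\<exists>u\<in>K. X u \<le> m"
proof (rule ccontr)
  assume "\<not> ?thesis"
  then have gt: "\<And>u. u \<in> K \<Longrightarrow> X u > m" by auto
  \<comment> \<open>A sum over an infinite set is 0 by default, so total weight 1 forces
    \<open>K\<close> to be finite.\<close>
  have fin: "finite K" using assms(2) by (metis sum.infinite zero_neq_one)
  obtain u where u: "u \<in> K" "q u > 0"
    using sum_nonpos[of K q] by (force simp: assms(2) not_less[symmetric])
  have "(\<Sum>u\<in>K. q u * m) < (\<Sum>u\<in>K. q u * X u)"
  proof (rule sum_strict_mono_ex1[OF fin])
    show "\<forall>u\<in>K. q u * m \<le> q u * X u" using gt assms(1) by (simp add: mult_left_mono less_imp_le)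
    show "\<exists>u\<in>K. q u * m < q u * X u" using gt u by (intro bexI[of _ u]) auto
  qed
  then show False using assms(2,3) by (simp flip: sum_distrib_right)
qed

lemma sum_pairs_insert:
  fixes h :: "'i \<Rightarrow> 'i \<Rightarrow> 'b::comm_monoid_add"
  assumes "finite S" "x \<notin> S"
  shows "(\<Sum>c\<in>insert x S. \<Sum>d\<in>insert x S - {c}. h c d) =
    (\<Sum>c\<in>S. \<Sum>d\<in>S - {c}. h c d) + (\<Sum>c\<in>S. h c x + h x c)"
proof -
  have "(\<Sum>d\<in>insert x S - {c}. h c d) = h c x + (\<Sum>d\<in>S - {c}. h c d)" if "c \<in> S" for c
  proof -
    have "insert x S - {c} = insert x (S - {c})" using that assms by auto
    then show ?thesis using assms by simp
  qed
  moreover have "insert x S - {x} = S" using assms by auto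
  ultimately show ?thesis using assms by (simp add: sum.distrib ac_simps)
qed

text \<open>Derandomisation: the linear part \<^term>\<open>g\<close> absorbs the pairs containing an index
  whose value has already been fixed.\<close>

lemma choice_le_average:
  fixes g :: "'i \<Rightarrow> 'a \<Rightarrow> real" and h :: "'i \<Rightarrow> 'i \<Rightarrow> 'a \<Rightarrow> 'a \<Rightarrow> real"
  assumes "finite S"
    and q: "\<And>c u. c \<in> S \<Longrightarrow> u \<in> K c \<Longrightarrow> q c u \<ge> 0" "\<And>c. c \<in> S \<Longrightarrow> sum (q c) (K c) = 1"
  shows "\<exists>f. (\<forall>c\<in>S. f c \<in> K c) \<and>
    (\<Sum>c\<in>S. g c (f c)) + (\<Sum>c\<in>S. \<Sum>d\<in>S - {c}. h c d (f c) (f d)) \<le>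
    (\<Sum>c\<in>S. \<Sum>u\<in>K c. q c u * g c u) +
    (\<Sum>c\<in>S. \<Sum>d\<in>S - {c}. \<Sum>u\<in>K c. \<Sum>v\<in>K d. q c u * q d v * h c d u v)"
  using assms
proof (induction S arbitrary: g)
  case empty
  then show ?case by simp
next
  case (insert x S)
  define g' where "g' y c v = g c v + (h c x v y + h x c y v)" for y c v
  define H where "H c d = (\<Sum>u\<in>K c. \<Sum>v\<in>K d. q c u * q d v * h c d u v)" for c d
  \<comment> \<open>\<open>A y\<close> is the expected cost of the remaining choices once
    \<open>x\<close> has the value \<open>y\<close>. The average of \<open>g x y + A y\<close> is
    the full expectation \<open>?m\<close>, so some \<open>y\<close> does not exceed it.\<close>
  define A where "A y = (\<Sum>c\<in>S. \<Sum>u\<in>K c. q c u * g' y c u) + (\<Sum>c\<in>S. \<Sum>d\<in>S - {c}. H c d)" for y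
  let ?m = "(\<Sum>c\<in>insert x S. \<Sum>u\<in>K c. q c u * g c u) + (\<Sum>c\<in>insert x S. \<Sum>d\<in>insert x S - {c}. H c d)"
  have qx: "sum (q x) (K x) = 1" using insert.prems(2) by simp
  have H1: "(\<Sum>y\<in>K x. q x y * (\<Sum>u\<in>K c. q c u * h c x u y)) = H c x" for c
    unfolding H_def sum_distrib_left by (subst sum.swap) (simp add: ac_simps)
  have H2: "(\<Sum>y\<in>K x. q x y * (\<Sum>u\<in>K c. q c u * h x c y u)) = H x c" for c
    unfolding H_def sum_distrib_left by (simp add: ac_simps)
  have "(\<Sum>y\<in>K x. q x y * (\<Sum>u\<in>K c. q c u * g' y c u)) = (\<Sum>u\<in>K c. q c u * g c u) + (H c x + H x c)" for c
  proof -
    have "(\<Sum>y\<in>K x. q x y * (\<Sum>u\<in>K c. q c u * g' y c u)) =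
       (\<Sum>y\<in>K x. q x y * (\<Sum>u\<in>K c. q c u * g c u)) +
       ((\<Sum>y\<in>K x. q x y * (\<Sum>u\<in>K c. q c u * h c x u y)) + (\<Sum>y\<in>K x. q x y * (\<Sum>u\<in>K c. q c u * h x c y u)))"
      by (simp add: g'_def distrib_left sum.distrib)
    then show ?thesis unfolding H1 H2 by (simp add: qx flip: sum_distrib_right)
  qed
  then have "(\<Sum>y\<in>K x. q x y * (\<Sum>c\<in>S. \<Sum>u\<in>K c. q c u * g' y c u)) =
      (\<Sum>c\<in>S. (\<Sum>u\<in>K c. q c u * g c u) + (H c x + H x c))"
    unfolding sum_distrib_left[of _ _ S] by (subst sum.swap) simp
  then have "(\<Sum>y\<in>K x. q x y * (g x y + A y)) = ?m"
    unfolding A_def sum_pairs_insert[OF insert.hyps] using insert.hyps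
    by (simp add: distrib_left sum.distrib qx flip: sum_distrib_right)
  then obtain y where y: "y \<in> K x" "g x y + A y \<le> ?m"
    using weighted_le_ex[of "K x" "q x" "\<lambda>y. g x y + A y" ?m] insert.prems by auto
  obtain f where f: "\<forall>c\<in>S. f c \<in> K c"
    "(\<Sum>c\<in>S. g' y c (f c)) + (\<Sum>c\<in>S. \<Sum>d\<in>S - {c}. h c d (f c) (f d)) \<le> A y"
    using insert.IH[of "g' y"] insert.prems unfolding A_def H_def by auto
  let ?f = "f(x := y)"
  have ne: "c \<noteq> x" if "c \<in> S" for c using that insert.hyps by auto
  have "(\<Sum>c\<in>insert x S. g c (?f c)) + (\<Sum>c\<in>insert x S. \<Sum>d\<in>insert x S - {c}. h c d (?f c) (?f d))
    = g x y + ((\<Sum>c\<in>S. g' y c (f c)) + (\<Sum>c\<in>S. \<Sum>d\<in>S - {c}. h c d (f c) (f d)))"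
    unfolding sum_pairs_insert[OF insert.hyps]
    using insert.hyps ne by (simp add: g'_def sum.distrib cong: sum.cong_simp)
  also have "\<dots> \<le> ?m" using f(2) y(2) by linarith
  finally have "(\<Sum>c\<in>insert x S. g c (?f c)) + (\<Sum>c\<in>insert x S. \<Sum>d\<in>insert x S - {c}. h c d (?f c) (?f d)) \<le> ?m" .
  moreover have "\<forall>c\<in>insert x S. ?f c \<in> K c" using f(1) y(1) ne by simp
  ultimately show ?case unfolding H_def by blast
qed

section \<open>From 1-degenerate sets to acyclic matchings\<close>

lemma card_le_acyclic_matching_number:
  assumes "finite E" "acyclic_matching E M"
  shows "card M \<le> acyclic_matching_number E"
proof -
  have "{M. acyclic_matching E M} \<subseteq> Pow E"
    by (auto simp: acyclic_matching_def matching_def)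
  then have "finite {M. acyclic_matching E M}" using assms(1) finite_subset by blast
  then show ?thesis
    unfolding acyclic_matching_number_def using assms(2) by (intro Max_ge) auto
qed

text \<open>The multiplicity between \<open>c\<close> and \<open>d\<close> in the multigraph
  obtained by contracting the pairs \<open>{c, f c}\<close> and \<open>{d, f d}\<close>.\<close>

definition edges_between :: "'a set set \<Rightarrow> ('a \<Rightarrow> 'a) \<Rightarrow> 'a \<Rightarrow> 'a \<Rightarrow> nat" where
  "edges_between E f c d = adj E c d + adj E c (f d) + adj E (f c) d + adj E (f c) (f d)"

lemma one_degenerate_finite: "one_degenerate w T \<Longrightarrow> finite T"
  by (induction rule: one_degenerate.induct) auto

text \<open>Matching edges are added in the degeneracy order, each by
  \<open>forest_insert_edge\<close>. The fixed superset \<open>U\<close> keeps the hypotheses on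
  \<open>f\<close> unchanged during the induction.\<close>

lemma one_degenerate_forest:
  assumes "one_degenerate (edges_between E f) T" "T \<subseteq> U"
    and disj: "\<And>c d. c \<in> U \<Longrightarrow> d \<in> U \<Longrightarrow> c \<noteq> d \<Longrightarrow> {c, f c} \<inter> {d, f d} = {}"
    and ne: "\<And>c. c \<in> U \<Longrightarrow> f c \<noteq> c"
  shows "forest (\<Union>c\<in>T. {c, f c}) (induced_edges E (\<Union>c\<in>T. {c, f c}))"
  using assms(1,2)
proof (induction rule: one_degenerate.induct)
  case empty
  show ?case by (auto simp: forest_def has_cycle_def)
next
  case (insert T u)
  let ?S = "\<Union>c\<in>T. {c, f c}"
  have fin: "finite T" using insert.hyps(1) by (rule one_degenerate_finite)
  have T: "T \<subseteq> U" "u \<in> U" using insert.prems by auto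
  \<comment> \<open>The pairs are disjoint and consist of two distinct vertices, so the edges from
    \<open>u\<close> and \<open>f u\<close> to \<open>?S\<close> add up to the multiplicities
    between \<open>u\<close> and \<open>T\<close>.\<close>
  have "(\<Sum>v\<in>?S. adj E u v + adj E (f u) v) = (\<Sum>c\<in>T. \<Sum>v\<in>{c, f c}. adj E u v + adj E (f u) v)"
    using fin T(1) disj by (intro sum.UNION_disjoint) auto
  also have "\<dots> = (\<Sum>c\<in>T. edges_between E f u c)"
  proof (rule sum.cong[OF refl])
    fix c assume "c \<in> T"
    then have "c \<noteq> f c" using ne[of c] T by auto
    then show "(\<Sum>v\<in>{c, f c}. adj E u v + adj E (f u) v) = edges_between E f u c"
      by (simp add: edges_between_def)
  qed
  finally have le: "(\<Sum>v\<in>?S. adj E u v + adj E (f u) v) \<le> 1" using insert.hyps(3) by simp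
  have "{u, f u} \<inter> {d, f d} = {}" if "d \<in> T" for d
    using that T insert.hyps(2) by (intro disj) auto
  then have "u \<notin> ?S" "f u \<notin> ?S" by blast+
  moreover have "u \<noteq> f u" using ne[OF T(2)] by simp
  moreover have "(\<Union>c\<in>insert u T. {c, f c}) = insert u (insert (f u) ?S)" by auto
  moreover have "finite ?S" using fin by auto
  ultimately show ?case
    using forest_insert_edge[of ?S E u "f u"] insert.IH T(1) le by metis
qed

lemma one_degenerate_le_acyclic_matching_number:
  assumes E: "finite E" and T: "one_degenerate (edges_between E f) T"
    and disj: "\<And>c d. c \<in> T \<Longrightarrow> d \<in> T \<Longrightarrow> c \<noteq> d \<Longrightarrow> {c, f c} \<inter> {d, f d} = {}"
    and ne: "\<And>c. c \<in> T \<Longrightarrow> f c \<noteq> c" and e: "\<And>c. c \<in> T \<Longrightarrow> {c, f c} \<in> E"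
  shows "card T \<le> acyclic_matching_number E"
proof -
  let ?M = "(\<lambda>c. {c, f c}) ` T"
  have "inj_on (\<lambda>c. {c, f c}) T" using disj by (intro inj_onI) blast
  then have "card ?M = card T" by (rule card_image)
  moreover have "matching E ?M"
    unfolding matching_def
  proof (intro conjI ballI impI)
    show "?M \<subseteq> E" using e by auto
    fix e1 e2 assume "e1 \<in> ?M" "e2 \<in> ?M" and ne: "e1 \<noteq> e2"
    then obtain c d where cd: "c \<in> T" "d \<in> T" "e1 = {c, f c}" "e2 = {d, f d}" by blast
    then have "c \<noteq> d" using ne by auto
    then show "e1 \<inter> e2 = {}" unfolding cd(3,4) by (rule disj[OF cd(1,2)])
  qed
  moreover have "forest (\<Union>?M) (induced_edges E (\<Union>?M))"
    using one_degenerate_forest[OF T order_refl disj ne] by simp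
  ultimately show ?thesis
    using card_le_acyclic_matching_number[OF E] by (metis acyclic_matching_def)
qed

section \<open>Expected degrees for random leaves\<close>

text \<open>AM-GM, \<^term>\<open>1 / (k * l) \<le> (1 / k\<^sup>2 + 1 / l\<^sup>2) / 2\<close>, decouples the two ends of an edge.\<close>

lemma average_le_decoupled:
  fixes y z :: "'a \<Rightarrow> real" and t :: "'a \<Rightarrow> 'a \<Rightarrow> real"
  assumes K: "finite K" "K \<noteq> {}" and L: "finite L" "L \<noteq> {}"
    and nonneg: "\<And>v. y v \<ge> 0" "\<And>u. z u \<ge> 0" "\<And>u v. t u v \<ge> 0"
  shows "(\<Sum>u\<in>K. \<Sum>v\<in>L. 1 / real (card K) * (1 / real (card L)) * (x + y v + z u + t u v)) \<le>
    ((x + sum y L + (1 / real (card K))\<^sup>2 * (\<Sum>u\<in>K. z u + (\<Sum>v\<in>L. t u v))) +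
     (x + sum z K + (1 / real (card L))\<^sup>2 * (\<Sum>v\<in>L. y v + (\<Sum>u\<in>K. t u v)))) / 2"
proof -
  define a b where "a = 1 / real (card K)" "b = 1 / real (card L)"
  have a: "real (card K) * a = 1" "real (card L) * b = 1" using K L by (auto simp: a_b_def)
  have e: "(\<Sum>u\<in>K. \<Sum>v\<in>L. a * b * (x + y v + z u + t u v)) =
     (real (card K) * a) * (real (card L) * b) * x + (real (card K) * a) * (b * sum y L)
     + (real (card L) * b) * (a * sum z K) + a * b * (\<Sum>u\<in>K. \<Sum>v\<in>L. t u v)"
    by (simp add: sum.distrib sum_distrib_left distrib_left mult_ac)
  have sw: "(\<Sum>v\<in>L. \<Sum>u\<in>K. t u v) = (\<Sum>u\<in>K. \<Sum>v\<in>L. t u v)" by (rule sum.swap)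
  have am: "r * s \<le> (r\<^sup>2 + s\<^sup>2) / 2" for r s :: real
    using zero_le_power2[of "r - s"] by (simp add: power2_eq_square algebra_simps)
  \<comment> \<open>A center is present with certainty, so a center-leaf term pairs 1 with
    \<open>a\<close> or \<open>b\<close>; only the leaf-leaf term carries
    \<open>a * b\<close>.\<close>
  have "1 * b * sum y L \<le> (1\<^sup>2 + b\<^sup>2) / 2 * sum y L" "1 * a * sum z K \<le> (1\<^sup>2 + a\<^sup>2) / 2 * sum z K"
    "a * b * (\<Sum>u\<in>K. \<Sum>v\<in>L. t u v) \<le> (a\<^sup>2 + b\<^sup>2) / 2 * (\<Sum>u\<in>K. \<Sum>v\<in>L. t u v)"
    using nonneg by (intro mult_right_mono am sum_nonneg; simp)+
  then have "x + b * sum y L + a * sum z K + a * b * (\<Sum>u\<in>K. \<Sum>v\<in>L. t u v) \<le>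
    ((x + sum y L + a\<^sup>2 * (sum z K + (\<Sum>u\<in>K. \<Sum>v\<in>L. t u v))) +
     (x + sum z K + b\<^sup>2 * (sum y L + (\<Sum>u\<in>K. \<Sum>v\<in>L. t u v)))) / 2"
    by (simp add: field_simps)
  then show ?thesis
    unfolding a_b_def[symmetric] e a by (simp add: sum.distrib sw)
qed

locale star_partition =
  fixes V :: "'a set" and E :: "'a set set" and \<Delta> :: nat and p :: "'a \<Rightarrow> 'a"
  assumes graph: "simple_graph V E"
    and degree_le: "\<And>v. v \<in> V \<Longrightarrow> degree E v \<le> \<Delta>"
    and star_map: "star_map E V p"
begin

definition centers :: "'a set" where
  "centers = {c \<in> V. p c = c}"

definition leaves :: "'a \<Rightarrow> 'a set" where
  "leaves c = {v \<in> V. v \<noteq> c \<and> p v = c}"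

lemma finite_V: "finite V" and edge_subset: "e \<in> E \<Longrightarrow> e \<subseteq> V" and no_loop: "{v, v} \<notin> E"
  using graph by (auto simp: simple_graph_def doubleton_eq_iff)

lemma finite_E: "finite E"
  using finite_V edge_subset by (intro finite_subset[of E "Pow V"]) auto

lemma finite_leaves: "finite (leaves c)" and finite_centers: "finite centers"
  using finite_V by (simp_all add: leaves_def centers_def)

lemma leaves_nonempty: "c \<in> centers \<Longrightarrow> leaves c \<noteq> {}"
  using star_map unfolding star_map_def centers_def leaves_def by blast

lemma leaf_edge: "v \<in> leaves c \<Longrightarrow> {c, v} \<in> E"
  using star_map by (auto simp: star_map_def leaves_def insert_commute)

lemma card_neighbours_le:
  assumes "v \<in> V"
  shows "card {u \<in> V. {v, u} \<in> E} \<le> \<Delta>"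
proof -
  have "inj_on (\<lambda>u. {v, u}) {u \<in> V. {v, u} \<in> E}"
    by (intro inj_onI) (auto simp: doubleton_eq_iff)
  then have "card {u \<in> V. {v, u} \<in> E} \<le> degree E v"
    unfolding degree_def using finite_E by (intro card_inj_on_le) auto
  then show ?thesis using degree_le[OF assms] by simp
qed

text \<open>The vertices of \<open>B\<close> are neighbours of \<open>u\<close> in the star of
  \<open>c\<close>, hence disjoint from the other stars. They use up \<open>card B\<close> of the at
  most \<open>\<Delta>\<close> neighbours of \<open>u\<close>.\<close>

lemma sum_adj_other_stars_le:
  assumes u: "u \<in> V" and S: "S \<subseteq> centers"
    and B: "B \<subseteq> {v \<in> V. {u, v} \<in> E \<and> p v = c}"
  shows "(\<Sum>d\<in>S - {c}. adj E u d + (\<Sum>v\<in>leaves d. adj E u v)) + card B \<le> \<Delta>"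
proof -
  let ?W = "\<Union>d\<in>S - {c}. insert d (leaves d)"
  have fin: "finite S" using S finite_centers finite_subset by blast
  have pW: "p v = d" if "d \<in> S" "v \<in> insert d (leaves d)" for v d
    using that S by (auto simp: leaves_def centers_def)
  have W: "finite ?W" "?W \<subseteq> V" using fin finite_leaves S by (auto simp: leaves_def centers_def)
  have "(\<Sum>d\<in>S - {c}. adj E u d + (\<Sum>v\<in>leaves d. adj E u v)) =
      (\<Sum>d\<in>S - {c}. \<Sum>v\<in>insert d (leaves d). adj E u v)"
  proof (rule sum.cong[OF refl])
    fix d
    have "d \<notin> leaves d" by (simp add: leaves_def)
    then show "adj E u d + (\<Sum>v\<in>leaves d. adj E u v) = (\<Sum>v\<in>insert d (leaves d). adj E u v)"
      using finite_leaves by simp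
  qed
  also have "\<dots> = (\<Sum>v\<in>?W. adj E u v)"
  proof (rule sum.UNION_disjoint[symmetric])
    show "\<forall>i\<in>S - {c}. \<forall>j\<in>S - {c}. i \<noteq> j \<longrightarrow> insert i (leaves i) \<inter> insert j (leaves j) = {}"
      using pW by (metis (no_types, lifting) DiffD1 disjoint_iff)
  qed (use fin finite_leaves in auto)
  also have "\<dots> = card {v\<in>?W. {u, v} \<in> E}" by (rule sum_adj[OF W(1)])
  also have "\<dots> + card B = card ({v\<in>?W. {u, v} \<in> E} \<union> B)"
  proof (rule card_Un_disjoint[symmetric])
    show "finite {v\<in>?W. {u, v} \<in> E}" using W(1) by (rule rev_finite_subset) auto
    show "finite B" using B finite_V by (auto intro: finite_subset)
    show "{v\<in>?W. {u, v} \<in> E} \<inter> B = {}"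
    proof (rule equals0I)
      fix v assume v: "v \<in> {v\<in>?W. {u, v} \<in> E} \<inter> B"
      then obtain d where "d \<in> S" "d \<noteq> c" "v \<in> insert d (leaves d)" by blast
      then have "p v \<noteq> c" using pW by simp
      then show False using v B by blast
    qed
  qed
  also have "\<dots> \<le> card {v\<in>V. {u, v} \<in> E}"
    using B W(2) finite_V by (intro card_mono) auto
  also have "\<dots> \<le> \<Delta>" using card_neighbours_le[OF u] .
  finally show ?thesis .
qed

text \<open>Summed over the chosen centers, this bounds the expected total degree in the contracted
  multigraph.\<close>

definition load :: "'a \<Rightarrow> real" where
  "load c = real \<Delta> - real (card (leaves c)) + (real \<Delta> - 1) / real (card (leaves c))"

text \<open>The part of the decoupled bound for the pair \<open>c\<close>, \<open>d\<close> that is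
  charged to \<open>c\<close>: the expected multiplicity is at most the mean of
  \<open>half_load c d\<close> and \<open>half_load d c\<close>.\<close>

definition half_load :: "'a \<Rightarrow> 'a \<Rightarrow> real" where
  "half_load c d = real (adj E c d) + (\<Sum>v\<in>leaves d. real (adj E c v)) +
    (1 / real (card (leaves c)))\<^sup>2 * (\<Sum>u\<in>leaves c. real (adj E u d) + (\<Sum>v\<in>leaves d. real (adj E u v)))"

text \<open>With \<open>k\<close> leaves, the center \<open>c\<close> sends at most
  \<open>\<Delta> - k\<close> edges to other stars. Each leaf sends at most
  \<open>\<Delta> - 1\<close>, and the \<open>k\<close> leaves have weight \<open>1 / k^2\<close>
  each, which gives \<open>(\<Delta> - 1) / k\<close>.\<close>

lemma sum_half_load_le:
  assumes S: "S \<subseteq> centers" and c: "c \<in> S"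
  shows "(\<Sum>d\<in>S - {c}. half_load c d) \<le> load c"
proof -
  let ?s = "\<lambda>u. (\<Sum>d\<in>S - {c}. adj E u d + (\<Sum>v\<in>leaves d. adj E u v))"
  have cV: "c \<in> V" "p c = c" using c S by (auto simp: centers_def)
  have k: "real (card (leaves c)) > 0"
    using leaves_nonempty[of c] c S finite_leaves by (auto simp: card_gt_0_iff)
  have "leaves c \<subseteq> {v \<in> V. {c, v} \<in> E \<and> p v = c}" using leaf_edge by (auto simp: leaves_def)
  from sum_adj_other_stars_le[OF cV(1) S this]
  have 1: "real (?s c) \<le> real \<Delta> - real (card (leaves c))" by linarith
  have "real (?s u) \<le> real \<Delta> - 1" if u: "u \<in> leaves c" for u
  proof -
    have "{c} \<subseteq> {v \<in> V. {u, v} \<in> E \<and> p v = c}"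
      using leaf_edge[OF u] cV by (simp add: insert_commute)
    from sum_adj_other_stars_le[OF _ S this, of] u
    have "?s u + 1 \<le> \<Delta>" by (simp add: leaves_def)
    then show ?thesis by linarith
  qed
  then have "(\<Sum>u\<in>leaves c. real (?s u)) \<le> (\<Sum>u\<in>leaves c. real \<Delta> - 1)" by (rule sum_mono)
  then have "(1 / real (card (leaves c)))\<^sup>2 * (\<Sum>u\<in>leaves c. real (?s u)) \<le>
      (1 / real (card (leaves c)))\<^sup>2 * (real (card (leaves c)) * (real \<Delta> - 1))"
    by (intro mult_left_mono) auto
  also have "\<dots> = (real \<Delta> - 1) / real (card (leaves c))"
    using k by (simp add: power2_eq_square)
  finally have 2: "(1 / real (card (leaves c)))\<^sup>2 * (\<Sum>u\<in>leaves c. real (?s u)) \<le> \<dots>" .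
  have "(\<Sum>d\<in>S - {c}. half_load c d) = real (?s c) + (1 / real (card (leaves c)))\<^sup>2 *
      (\<Sum>d\<in>S - {c}. \<Sum>u\<in>leaves c. real (adj E u d) + (\<Sum>v\<in>leaves d. real (adj E u v)))"
    by (simp add: half_load_def sum.distrib flip: sum_distrib_left)
  also have "(\<Sum>d\<in>S - {c}. \<Sum>u\<in>leaves c. real (adj E u d) + (\<Sum>v\<in>leaves d. real (adj E u v))) =
      (\<Sum>u\<in>leaves c. real (?s u))"
    by (subst sum.swap) simp
  finally show ?thesis using 1 2 unfolding load_def by linarith
qed

text \<open>For uniformly random leaves the two halves of the decoupled bound have equal sums over
  ordered pairs, so the average total is at most the sum of the loads; some choice attains at most
  this.\<close>

lemma exists_leaf_choice:
  assumes S: "S \<subseteq> centers"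
  shows "\<exists>f. (\<forall>c\<in>S. f c \<in> leaves c) \<and>
    real (\<Sum>c\<in>S. \<Sum>d\<in>S - {c}. edges_between E f c d) \<le> (\<Sum>c\<in>S. load c)"
proof -
  define q where "q c u = 1 / real (card (leaves c))" for c u :: 'a
  define h where "h c d u v = real (adj E c d) + real (adj E c v) + real (adj E u d) + real (adj E u v)"
    for c d u v
  have fin: "finite S" using S finite_centers finite_subset by blast
  have ne: "leaves c \<noteq> {}" if "c \<in> S" for c using that S leaves_nonempty by blast
  have "sum (q c) (leaves c) = 1" if "c \<in> S" for c
    using ne[OF that] finite_leaves by (simp add: q_def)
  then obtain f where f: "\<forall>c\<in>S. f c \<in> leaves c"
    "(\<Sum>c\<in>S. \<Sum>d\<in>S - {c}. h c d (f c) (f d)) \<le>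
      (\<Sum>c\<in>S. \<Sum>d\<in>S - {c}. \<Sum>u\<in>leaves c. \<Sum>v\<in>leaves d. q c u * q d v * h c d u v)"
    using choice_le_average[OF fin, of leaves q "\<lambda>_ _. 0" h] by (auto simp: q_def)
  note f(2)
  also have "(\<Sum>c\<in>S. \<Sum>d\<in>S - {c}. \<Sum>u\<in>leaves c. \<Sum>v\<in>leaves d. q c u * q d v * h c d u v) \<le>
      (\<Sum>c\<in>S. \<Sum>d\<in>S - {c}. (half_load c d + half_load d c) / 2)"
  proof (intro sum_mono)
    fix c d assume "c \<in> S" "d \<in> S - {c}"
    then have "leaves c \<noteq> {}" "leaves d \<noteq> {}" using ne by auto
    then show "(\<Sum>u\<in>leaves c. \<Sum>v\<in>leaves d. q c u * q d v * h c d u v) \<le>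
        (half_load c d + half_load d c) / 2"
      unfolding q_def h_def half_load_def adj_commute[of E d] adj_commute[of E _ c]
      using average_le_decoupled[of "leaves c" "leaves d" "\<lambda>v. real (adj E c v)"
        "\<lambda>u. real (adj E u d)" "\<lambda>u v. real (adj E u v)" "real (adj E c d)"] finite_leaves
      by (simp add: adj_commute)
  qed
  also have "\<dots> = ((\<Sum>c\<in>S. \<Sum>d\<in>S - {c}. half_load c d) + (\<Sum>c\<in>S. \<Sum>d\<in>S - {c}. half_load d c)) / 2"
    by (simp add: sum.distrib add_divide_distrib sum_divide_distrib)
  also have "(\<Sum>c\<in>S. \<Sum>d\<in>S - {c}. half_load d c) = (\<Sum>c\<in>S. \<Sum>d\<in>S - {c}. half_load c d)"
    using fin by (rule sum_offdiag_swap)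
  also have "((\<Sum>c\<in>S. \<Sum>d\<in>S - {c}. half_load c d) + (\<Sum>c\<in>S. \<Sum>d\<in>S - {c}. half_load c d)) / 2
      \<le> (\<Sum>c\<in>S. load c)"
    using sum_mono[of S "\<lambda>c. \<Sum>d\<in>S - {c}. half_load c d" load] sum_half_load_le[OF S] by simp
  finally show ?thesis using f(1) by (intro exI[of _ f]) (simp add: h_def edges_between_def)
qed

section \<open>Lower bounds on the acyclic matching number\<close>

text \<open>Only the total degree is controlled, so the convex bound \<open>2 / x\<close> is
  replaced by a linear one; \<open>D\<close> is free, to be tuned to the stars in
  \<open>S\<close>.\<close>

lemma matching_lower_bound:
  assumes S: "S \<subseteq> centers" and D: "D > 0"
  shows "(\<Sum>c\<in>S. 4 / D - 2 * (load c + 2) / D\<^sup>2) \<le> real (acyclic_matching_number E)"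
proof -
  obtain f where f: "\<And>c. c \<in> S \<Longrightarrow> f c \<in> leaves c"
    "real (\<Sum>c\<in>S. \<Sum>d\<in>S - {c}. edges_between E f c d) \<le> (\<Sum>c\<in>S. load c)"
    using exists_leaf_choice[OF S] by blast
  have fin: "finite S" using S finite_centers finite_subset by blast
  define x where "x c = real (\<Sum>d\<in>S - {c}. edges_between E f c d) + 2" for c
  obtain T where T: "T \<subseteq> S" "one_degenerate (edges_between E f) T"
    "(\<Sum>c\<in>S. 2 / x c) \<le> real (card T)"
    using one_degenerate_subset[OF fin] unfolding x_def by blast
  \<comment> \<open>The tangent to \<open>2 / x\<close> at \<open>x = D\<close>; the gap is a square
    divided by a positive number.\<close>
  have tangent: "4 / D - 2 * x c / D\<^sup>2 \<le> 2 / x c" for c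
  proof -
    have "x c > 0" unfolding x_def by (intro add_nonneg_pos of_nat_0_le_iff) simp
    moreover from this have "2 / x c - (4 / D - 2 * x c / D\<^sup>2) = 2 * (D - x c)\<^sup>2 / (x c * D\<^sup>2)"
      using D by (simp add: field_simps power2_eq_square)
    ultimately show ?thesis using D by (smt (verit) divide_nonneg_nonneg mult_nonneg_nonneg zero_le_power2)
  qed
  have "sum x S \<le> (\<Sum>c\<in>S. load c + 2)" using f(2) by (simp add: x_def sum.distrib)
  then have "(\<Sum>c\<in>S. 4 / D) - 2 / D\<^sup>2 * (\<Sum>c\<in>S. load c + 2) \<le> (\<Sum>c\<in>S. 4 / D) - 2 / D\<^sup>2 * sum x S"
    by (intro diff_mono mult_left_mono) auto
  then have "(\<Sum>c\<in>S. 4 / D - 2 * (load c + 2) / D\<^sup>2) \<le> (\<Sum>c\<in>S. 4 / D - 2 * x c / D\<^sup>2)"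
    unfolding sum_subtractf by (simp add: sum_distrib_left)
  also have "\<dots> \<le> (\<Sum>c\<in>S. 2 / x c)" by (intro sum_mono tangent)
  also have "\<dots> \<le> real (card T)" by (rule T(3))
  also have "card T \<le> acyclic_matching_number E"
  proof (rule one_degenerate_le_acyclic_matching_number[OF finite_E T(2)])
    fix c assume c: "c \<in> T"
    then have "f c \<in> leaves c" using f(1) T(1) by blast
    then show "f c \<noteq> c" "{c, f c} \<in> E" by (auto simp: leaf_edge) (simp add: leaves_def)
    fix d assume d: "d \<in> T" "c \<noteq> d"
    have "p c = c" "p (f c) = c" "p d = d" "p (f d) = d"
      using f(1)[of c] f(1)[of d] c d T(1) S by (auto simp: leaves_def centers_def)
    then show "{c, f c} \<inter> {d, f d} = {}" using d(2) by auto
  qed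
  finally show ?thesis by simp
qed

lemma card_V: "card V = (\<Sum>c\<in>centers. card (leaves c) + 1)"
proof -
  have V: "V = (\<Union>c\<in>centers. insert c (leaves c))"
    using star_map by (auto simp: star_map_def centers_def leaves_def)
  have disj: "insert c (leaves c) \<inter> insert d (leaves d) = {}" if "c \<in> centers" "d \<in> centers" "c \<noteq> d" for c d
    using that by (auto simp: centers_def leaves_def)
  have "card V = (\<Sum>c\<in>centers. card (insert c (leaves c)))"
    by (subst V, rule card_UN_disjoint) (use finite_centers finite_leaves disj in auto)
  also have "\<dots> = (\<Sum>c\<in>centers. card (leaves c) + 1)"
    using finite_leaves by (intro sum.cong refl) (simp add: leaves_def card_insert_if)
  finally show ?thesis .
qed

text \<open>The hypothesis on \<open>D\<close> makes \<open>4 * D - 2 * (load c + 2)\<close> at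
  least twice the number of vertices of the star. The summand \<open>- k\<close> in
  \<open>load\<close> supplies the dependence on the star size \<open>k + 1\<close>.\<close>

lemma matching_lower_bound_uniform:
  assumes S: "S \<subseteq> centers" and D: "D > 0"
    and le: "\<And>c. c \<in> S \<Longrightarrow> real \<Delta> + 3 + (real \<Delta> - 1) / real (card (leaves c)) \<le> 2 * D"
  shows "2 / D\<^sup>2 * real (\<Sum>c\<in>S. card (leaves c) + 1) \<le> real (acyclic_matching_number E)"
proof -
  have "2 / D\<^sup>2 * real (\<Sum>c\<in>S. card (leaves c) + 1) = (\<Sum>c\<in>S. 2 / D\<^sup>2 * (real (card (leaves c)) + 1))"
    by (simp only: of_nat_sum sum_distrib_left of_nat_add of_nat_1)
  also have "\<dots> \<le> (\<Sum>c\<in>S. 4 / D - 2 * (load c + 2) / D\<^sup>2)"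
  proof (rule sum_mono)
    fix c assume "c \<in> S"
    moreover define x where "x = (real \<Delta> - 1) / real (card (leaves c))"
    ultimately have "real \<Delta> + 3 + x \<le> 2 * D" using le by blast
    then have "2 * (real (card (leaves c)) + 1) \<le> 4 * D - 2 * (load c + 2)"
      unfolding load_def x_def[symmetric] by (simp add: algebra_simps)
    then have "2 * (real (card (leaves c)) + 1) / D\<^sup>2 \<le> (4 * D - 2 * (load c + 2)) / D\<^sup>2"
      by (rule divide_right_mono) simp
    also have "\<dots> = 4 / D - 2 * (load c + 2) / D\<^sup>2"
      using D by (simp add: diff_divide_distrib power2_eq_square)
    finally show "2 / D\<^sup>2 * (real (card (leaves c)) + 1) \<le> \<dots>" by simp
  qed
  also have "\<dots> \<le> real (acyclic_matching_number E)" by (rule matching_lower_bound[OF S D])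
  finally show ?thesis .
qed

text \<open>With \<open>D = 2 * \<Delta>\<close> every star contributes at least
  \<open>1 / \<Delta>\<close>, whatever its size, because
  \<open>load c + 2 \<le> 2 * \<Delta>\<close> already for one leaf. A star counted here has at most
  \<open>m + 1\<close> vertices.\<close>

lemma matching_lower_bound_small_stars:
  assumes S: "S \<subseteq> centers" and D: "\<Delta> > 0" and le: "\<And>c. c \<in> S \<Longrightarrow> card (leaves c) \<le> m"
  shows "real (\<Sum>c\<in>S. card (leaves c) + 1) \<le> (real m + 1) * real \<Delta> * real (acyclic_matching_number E)"
proof -
  have "real (\<Sum>c\<in>S. card (leaves c) + 1) \<le> (\<Sum>c\<in>S. real m + 1)"
    unfolding of_nat_sum using le by (intro sum_mono) simp
  also have "\<dots> = (real m + 1) * real \<Delta> * (\<Sum>c\<in>S. 1 / real \<Delta>)"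
    using D by simp
  also have "(\<Sum>c\<in>S. 1 / real \<Delta>) \<le> (\<Sum>c\<in>S. 4 / (2 * real \<Delta>) - 2 * (load c + 2) / (2 * real \<Delta>)\<^sup>2)"
  proof (rule sum_mono)
    fix c assume "c \<in> S"
    then have "leaves c \<noteq> {}" using leaves_nonempty S by auto
    then have "card (leaves c) \<noteq> 0" using finite_leaves by simp
    then have k: "real (card (leaves c)) \<ge> 1" by simp
    have "(real \<Delta> - 1) / real (card (leaves c)) \<le> (real \<Delta> - 1) / 1"
      using k D by (intro divide_left_mono) auto
    then have "load c + 2 \<le> 2 * real \<Delta>" unfolding load_def using k by simp
    then have "2 * (load c + 2) / (2 * real \<Delta>)\<^sup>2 \<le> 2 * (2 * real \<Delta>) / (2 * real \<Delta>)\<^sup>2"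
      by (intro divide_right_mono mult_left_mono) auto
    also have "\<dots> = 1 / real \<Delta>" using D by (simp add: power2_eq_square)
    finally show "1 / real \<Delta> \<le> 4 / (2 * real \<Delta>) - 2 * (load c + 2) / (2 * real \<Delta>)\<^sup>2" by simp
  qed
  also have "\<dots> \<le> real (acyclic_matching_number E)" using D by (intro matching_lower_bound[OF S]) simp
  finally show ?thesis by (simp add: mult_left_mono)
qed

lemma acyclic_matching_number_ge:
  assumes D: "\<Delta> > 0"
  shows "6 * real (card V) \<le> ((real \<Delta>)\<^sup>2 + 12 * (sqrt (real \<Delta>)) ^ 3) * real (acyclic_matching_number E)"
proof -
  define s where "s = sqrt (real \<Delta>)"
  define \<nu> where "\<nu> = real (acyclic_matching_number E)"
  have s: "s \<ge> 1" "real \<Delta> = s\<^sup>2" "s\<^sup>2 \<ge> 1" and \<nu>: "\<nu> \<ge> 0" using D by (auto simp: s_def \<nu>_def)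
  have k: "real (card (leaves c)) \<ge> 1" if "c \<in> centers" for c
    using leaves_nonempty[OF that] finite_leaves[of c] by (metis card_0_eq less_one not_less of_nat_1 of_nat_le_iff)
  show ?thesis
  proof (cases "s \<le> 4")
    case True
    \<comment> \<open>\<open>D = \<Delta> + 1\<close> is the least value that the hypothesis admits
      for a star with one leaf.\<close>
    have "2 / (s\<^sup>2 + 1)\<^sup>2 * real (\<Sum>c\<in>centers. card (leaves c) + 1) \<le> \<nu>"
      unfolding \<nu>_def
    proof (rule matching_lower_bound_uniform[OF order_refl])
      show "s\<^sup>2 + 1 > 0" using s by linarith
      fix c assume "c \<in> centers"
      from k[OF this] have "(real \<Delta> - 1) / real (card (leaves c)) \<le> (real \<Delta> - 1) / 1"
        using s by (intro divide_left_mono) auto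
      then show "real \<Delta> + 3 + (real \<Delta> - 1) / real (card (leaves c)) \<le> 2 * (s\<^sup>2 + 1)"
        using s by simp
    qed
    then have "2 / (s\<^sup>2 + 1)\<^sup>2 * real (card V) \<le> \<nu>" by (simp only: card_V)
    moreover have "(s\<^sup>2 + 1)\<^sup>2 > 0" using s by simp
    ultimately have "6 * real (card V) \<le> 3 * (s\<^sup>2 + 1)\<^sup>2 * \<nu>" by (simp add: field_simps)
    also have "3 * (s\<^sup>2 + 1)\<^sup>2 \<le> (s\<^sup>2)\<^sup>2 + 12 * s ^ 3"
    proof -
      \<comment> \<open>The sign holds for \<open>s\<close> between 1 and 5; the resulting
        \<open>- 4 * s^2\<close> absorbs the constant 3, as \<open>s \<ge> 1\<close>.\<close>
      have "(s - 1) * (s - 5) \<le> 0" using s True by (intro mult_nonneg_nonpos) auto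
      then have "2 * s\<^sup>2 - 12 * s + 6 \<le> - 4" by (simp add: power2_eq_square algebra_simps)
      then have "s\<^sup>2 * (2 * s\<^sup>2 - 12 * s + 6) \<le> s\<^sup>2 * (- 4)" by (intro mult_left_mono) auto
      moreover have "3 * (s\<^sup>2 + 1)\<^sup>2 - ((s\<^sup>2)\<^sup>2 + 12 * s ^ 3) = s\<^sup>2 * (2 * s\<^sup>2 - 12 * s + 6) + 3"
        by algebra
      ultimately show ?thesis using s by linarith
    qed
    finally show ?thesis using \<nu> s by (simp add: mult_right_mono flip: s_def \<nu>_def)
  next
    case False
    \<comment> \<open>Seven is the least \<open>k\<close> with
      \<open>3 / 4 * (1 + 1 / k)^2 \<le> 1\<close>, the leading coefficient of
      \<open>3 * D^2\<close> in terms of \<open>\<Delta>\<close>; for 7 it is 48/49.\<close>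
    define A where "A = {c \<in> centers. card (leaves c) \<ge> 7}"
    define B where "B = {c \<in> centers. card (leaves c) \<le> 6}"
    define a b where "a = real (\<Sum>c\<in>A. card (leaves c) + 1)" "b = real (\<Sum>c\<in>B. card (leaves c) + 1)"
    \<comment> \<open>Equality in the hypothesis of \<open>matching_lower_bound_uniform\<close> for
      a star with seven leaves.\<close>
    define D where "D = (4 * s\<^sup>2 + 10) / 7"
    have D: "D > 0" using s by (simp add: D_def)
    have "centers = A \<union> B" "A \<inter> B = {}" "finite A" "finite B"
      using finite_centers by (auto simp: A_def B_def)
    then have n: "real (card V) = a + b"
      unfolding card_V a_b_def by (simp only: sum.union_disjoint of_nat_add)
    have "b \<le> (real 6 + 1) * real \<Delta> * \<nu>"
      unfolding a_b_def \<nu>_def by (rule matching_lower_bound_small_stars) (use assms in \<open>auto simp: B_def\<close>)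
    then have b: "b \<le> 7 * s\<^sup>2 * \<nu>" using s by simp
    have "2 / D\<^sup>2 * a \<le> \<nu>"
      unfolding a_b_def \<nu>_def
    proof (rule matching_lower_bound_uniform[OF _ D])
      fix c assume "c \<in> A"
      then have "real (card (leaves c)) \<ge> 7" by (simp add: A_def)
      then have "(real \<Delta> - 1) / real (card (leaves c)) \<le> (real \<Delta> - 1) / 7"
        using s by (intro divide_left_mono) auto
      then show "real \<Delta> + 3 + (real \<Delta> - 1) / real (card (leaves c)) \<le> 2 * D"
        using s by (simp add: D_def)
    qed (simp add: A_def)
    then have a: "a \<le> D\<^sup>2 / 2 * \<nu>" using D by (simp add: field_simps)
    have "6 * real (card V) \<le> (3 * D\<^sup>2 + 42 * s\<^sup>2) * \<nu>"
      using a b unfolding n by (simp add: algebra_simps)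
    \<comment> \<open>Since \<open>s > 4\<close>, \<open>12 * s^3\<close> exceeds
      \<open>48 * s^2\<close>, which covers \<open>42 * s^2\<close> and, by
      \<open>s^2 \<ge> 16\<close>, the lower order terms \<open>(240 * s^2 + 300) / 49\<close> of
      \<open>3 * D^2\<close>.\<close>
    also have "3 * D\<^sup>2 + 42 * s\<^sup>2 \<le> (s\<^sup>2)\<^sup>2 + 12 * s ^ 3"
    proof -
      have s2: "s\<^sup>2 \<ge> 16" using False power_mono[of 4 s 2] by simp
      have "3 * D\<^sup>2 = (48 * (s\<^sup>2)\<^sup>2 + 240 * s\<^sup>2 + 300) / 49"
        by (simp add: D_def power2_eq_square field_simps)
      moreover have "48 * s\<^sup>2 \<le> 12 * s ^ 3"
        using mult_right_mono[of 4 s "s\<^sup>2"] False by (simp add: power2_eq_square power3_eq_cube)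
      moreover have "(s\<^sup>2)\<^sup>2 \<ge> 0" by simp
      ultimately show ?thesis using s2 by argo
    qed
    finally show ?thesis using \<nu> s by (simp add: mult_right_mono flip: s_def \<nu>_def)
  qed
qed

end

theorem theorem1:
  fixes V :: "'a set" and E :: "'a set set" and \<Delta> :: nat
  assumes "simple_graph V E"
    and "\<Delta> > 0"
    and "\<forall>v\<in>V. degree E v \<le> \<Delta>"
    and "\<forall>v\<in>V. degree E v \<ge> 1"
  shows "real (acyclic_matching_number E) \<ge>
           6 * real (card V) / ((real \<Delta>)^2 + 12 * (real \<Delta>) powr (3/2))"
proof -
  have "\<exists>u\<in>V. {v, u} \<in> E \<and> v \<noteq> u" if "v \<in> V" for v
  proof -
    have "{e \<in> E. v \<in> e} \<noteq> {}"
      using assms(4) that unfolding degree_def by (metis card.empty not_one_le_zero)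
    then obtain e where "e \<in> E" "v \<in> e" by blast
    then show ?thesis using assms(1) unfolding simple_graph_def by (metis insert_commute insertE singletonD)
  qed
  then obtain p where "star_map E V p"
    using star_map_exists[of V E] assms(1) by (auto simp: simple_graph_def)
  then interpret star_partition V E \<Delta> p
    using assms(1,3) by unfold_locales auto
  have "sqrt (real \<Delta>) ^ 3 = (real \<Delta>) powr (3/2)"
    using assms(2) by (simp add: powr_half_sqrt[symmetric] powr_powr flip: powr_realpow)
  moreover have "(real \<Delta>)\<^sup>2 + 12 * (real \<Delta>) powr (3/2) > 0"
    using assms(2) by (intro add_pos_nonneg) auto
  ultimately show ?thesis
    using acyclic_matching_number_ge[OF assms(2)] by (simp add: divide_le_eq mult.commute)
qed

end
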